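(* Suppose that $c:\mathbb{X}\times\mathbb{U}\to\mathbb{R}$ is non-negative, measurable, and bounded. Then the optimal cost $J(P,\cdot)$ is continuous on the set of channels $\mathcal{Q}$ under the topology of total variation: if $\{Q_n\}$ is a sequence in $\mathcal{Q}$ converging in total variation at input $P$ to $Q\in\mathcal{Q}$, then $J(P,Q_n)\to J(P,Q)$.
   Context: $\mathbb{X}\subset\mathbb{R}^n$, $\mathbb{Y}\subset\mathbb{R}^m$ and $\mathbb{U}\subset\mathbb{R}^k$ are Borel sets ($\mathbb{U}$ nonempty). A channel $Q$ is a stochastic kernel from $\mathbb{X}$ to $\mathbb{Y}$: $Q(\cdot|x)$ is a Borel probability measure on $\mathbb{Y}$ for every $x\in\mathbb{X}$, and $x\mapsto Q(A|x)$ is Borel measurable for every Borel $A\subset\mathbb{Y}$. $\mathcal{Q}$ is the set of all channels from $\mathbb{X}$ to $\mathbb{Y}$. $P$ is a fixed Borel probability measure on $\mathbb{X}$, and $PQ$ is the joint probability measure on $\mathbb{X}\times\mathbb{Y}$ given by $PQ(A)=\int_A Q(dy|x)P(dx)$. The single-stage optimal cost is $$J(P,Q)=\inf_{\gamma\in\mathcal{G}}\int_{\mathbb{X}\times\mathbb{Y}} c(x,\gamma(y))\,Q(dy|x)P(dx),$$ where $\mathcal{G}$ is the set of all Borel measurable functions $\gamma:\mathbb{Y}\to\mathbb{U}$. For probability measures, $\|\mu-\nu\|_{TV}=2\sup_B|\mu(B)-\nu(B)|$ (supremum over Borel sets). $Q_n\to Q$ in total variation at input $P$ means that $\|PQ_n-PQ\|_{TV}\to0$.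 This convergence is metrizable on the set of channels after identifying $Q,Q'$ with $PQ=PQ'$. *)

theory Defs
  imports "HOL-Probability.Probability"
begin

abbreviation borel_on :: "'a::topological_space set \<Rightarrow> 'a measure" where
  "borel_on S \<equiv> restrict_space borel S"

text \<open>
  Stochastic kernels are the measurable maps into the Giry space of probability measures;
  \<open>channels_iff\<close> below spells this out. The values of a channel outside \<open>X\<close> are unconstrained
  and never used, as every measure on \<open>X\<close> below has \<open>X\<close> as its space.
\<close>

definition channels :: "'a::topological_space set \<Rightarrow> 'b::topological_space set
    \<Rightarrow> ('a \<Rightarrow> 'b measure) set" where
  "channels X Y = borel_on X \<rightarrow>\<^sub>M prob_algebra (borel_on Y)"

lemma channels_iff:
  "Q \<in> channels X Y \<longleftrightarrow>
    (\<forall>x\<in>X. prob_space (Q x) \<and> sets (Q x) = sets (borel_on Y)) \<and>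
    (\<forall>A\<in>sets (borel_on Y). (\<lambda>x. measure (Q x) A) \<in> borel_measurable (borel_on X))"
proof
  assume Q: "Q \<in> channels X Y"
  then have s: "Q \<in> borel_on X \<rightarrow>\<^sub>M subprob_algebra (borel_on Y)"
    unfolding channels_def by (rule measurable_prob_algebraD)
  have "Q x \<in> space (prob_algebra (borel_on Y))" if "x \<in> X" for x
    using measurable_space[OF Q[unfolded channels_def], of x] that by (simp add: space_restrict_space)
  moreover have "(\<lambda>x. measure (Q x) A) \<in> borel_measurable (borel_on X)"
    if "A \<in> sets (borel_on Y)" for A
    using measurable_compose[OF s measurable_measure_subprob_algebra[OF that]] .
  ultimately show "(\<forall>x\<in>X. prob_space (Q x) \<and> sets (Q x) = sets (borel_on Y)) \<and>
    (\<forall>A\<in>sets (borel_on Y). (\<lambda>x. measure (Q x) A) \<in> borel_measurable (borel_on X))"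
    by (auto simp: space_prob_algebra)
next
  assume *: "(\<forall>x\<in>X. prob_space (Q x) \<and> sets (Q x) = sets (borel_on Y)) \<and>
    (\<forall>A\<in>sets (borel_on Y). (\<lambda>x. measure (Q x) A) \<in> borel_measurable (borel_on X))"
  have "Q \<in> borel_on X \<rightarrow>\<^sub>M subprob_algebra (borel_on Y)"
  proof (rule measurable_subprob_algebra)
    fix A assume A: "A \<in> sets (borel_on Y)"
    have "(\<lambda>x. ennreal (measure (Q x) A)) \<in> borel_measurable (borel_on X)"
      using * A by (intro measurable_compose[OF _ measurable_ennreal]) auto
    then show "(\<lambda>x. emeasure (Q x) A) \<in> borel_measurable (borel_on X)"
      by (rule measurable_cong[THEN iffD1, rotated])
         (use * in \<open>auto simp: space_restrict_space finite_measure.emeasure_eq_measure prob_space.finite_measure\<close>)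
  qed (use * in \<open>auto simp: space_restrict_space prob_space_imp_subprob_space\<close>)
  then show "Q \<in> channels X Y"
    unfolding channels_def using * by (auto intro!: measurable_prob_algebraI simp: space_restrict_space)
qed

text \<open>The joint measure \<open>PQ(A) = \<integral>\<^sub>A Q(dy|x) P(dx)\<close> on \<open>X \<times> Y\<close>, where \<open>P\<close> carries \<open>X\<close>.\<close>

definition joint_measure :: "'b::topological_space set \<Rightarrow> 'a measure \<Rightarrow> ('a \<Rightarrow> 'b measure)
    \<Rightarrow> ('a \<times> 'b) measure" where
  "joint_measure Y P Q = measure_of (space P \<times> Y) (sets (P \<Otimes>\<^sub>M borel_on Y))
     (\<lambda>A. \<integral>\<^sup>+ x. emeasure (Q x) (Pair x -` A) \<partial>P)"

lemma sets_joint_measure: "sets (joint_measure Y P Q) = sets (P \<Otimes>\<^sub>M borel_on Y)"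
proof -
  have "space P \<times> Y = space (P \<Otimes>\<^sub>M borel_on Y)"
    by (simp add: space_pair_measure space_restrict_space)
  then show ?thesis
    unfolding joint_measure_def by (simp only: sets.sets_measure_of_eq)
qed

lemma space_joint_measure: "space (joint_measure Y P Q) = space P \<times> Y"
  using sets_eq_imp_space_eq[OF sets_joint_measure]
  by (simp add: space_pair_measure space_restrict_space)

lemma emeasure_joint_measure:
  fixes X :: "'a::topological_space set" and Y :: "'b::topological_space set"
  assumes P: "sets P = sets (borel_on X)" and Q: "Q \<in> channels X Y"
    and A: "A \<in> sets (P \<Otimes>\<^sub>M borel_on Y)"
  shows "emeasure (joint_measure Y P Q) A = (\<integral>\<^sup>+ x. emeasure (Q x) (Pair x -` A) \<partial>P)"
proof (rule emeasure_measure_of[OF joint_measure_def])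
  have sp: "space P \<times> Y = space (P \<Otimes>\<^sub>M borel_on Y)"
    by (simp add: space_pair_measure space_restrict_space)
  show "sets (P \<Otimes>\<^sub>M borel_on Y) \<subseteq> Pow (space P \<times> Y)"
    unfolding sp by (rule sets.space_closed)
  show "A \<in> sets (joint_measure Y P Q)"
    using A by (simp add: sets_joint_measure)
  show "positive (sets (joint_measure Y P Q)) (\<lambda>A. \<integral>\<^sup>+ x. emeasure (Q x) (Pair x -` A) \<partial>P)"
    by (simp add: positive_def)
  have s: "Q \<in> P \<rightarrow>\<^sub>M subprob_algebra (borel_on Y)"
    using measurable_prob_algebraD[OF Q[unfolded channels_def]] P
    by (simp cong: measurable_cong_sets)
  have setsQ: "sets (Q x) = sets (borel_on Y)" if "x \<in> space P" for x
    using s that by (rule sets_kernel)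
  show "countably_additive (sets (joint_measure Y P Q))
      (\<lambda>A. \<integral>\<^sup>+ x. emeasure (Q x) (Pair x -` A) \<partial>P)"
    unfolding countably_additive_def sets_joint_measure
  proof (intro allI impI)
    fix B :: "nat \<Rightarrow> ('a \<times> 'b) set"
    assume B: "range B \<subseteq> sets (P \<Otimes>\<^sub>M borel_on Y)" "disjoint_family B"
    have Bi: "B i \<in> sets (P \<Otimes>\<^sub>M borel_on Y)" for i using B by auto
    have m: "(\<lambda>x. emeasure (Q x) (Pair x -` B i)) \<in> borel_measurable P" for i
    proof (rule emeasure_measurable_subprob_algebra2[OF _ s])
      have "(SIGMA x:space P. Pair x -` B i) = B i"
        using sets.sets_into_space[OF Bi[of i]] by (auto simp: space_pair_measure)
      then show "(SIGMA x:space P. Pair x -` B i) \<in> sets (P \<Otimes>\<^sub>M borel_on Y)"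
        using Bi by simp
    qed
    have "(\<Sum>i. \<integral>\<^sup>+ x. emeasure (Q x) (Pair x -` B i) \<partial>P)
        = (\<integral>\<^sup>+ x. (\<Sum>i. emeasure (Q x) (Pair x -` B i)) \<partial>P)"
      by (rule nn_integral_suminf[symmetric]) (rule m)
    also have "\<dots> = (\<integral>\<^sup>+ x. emeasure (Q x) (Pair x -` (\<Union>i. B i)) \<partial>P)"
    proof (rule nn_integral_cong)
      fix x assume x: "x \<in> space P"
      have "(\<Sum>i. emeasure (Q x) (Pair x -` B i)) = emeasure (Q x) (\<Union>i. Pair x -` B i)"
        using B(2) Bi by (intro suminf_emeasure)
          (auto simp: setsQ[OF x] sets_Pair1 disjoint_family_on_def)
      then show "(\<Sum>i. emeasure (Q x) (Pair x -` B i)) = emeasure (Q x) (Pair x -` (\<Union>i. B i))"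
        by (simp add: vimage_UN)
    qed
    finally show "(\<Sum>i. \<integral>\<^sup>+ x. emeasure (Q x) (Pair x -` B i) \<partial>P)
        = (\<integral>\<^sup>+ x. emeasure (Q x) (Pair x -` (\<Union>i. B i)) \<partial>P)" .
  qed
qed

text \<open>Meant for probability measures with the same measurable sets; the supremum is then over
  a set bounded by 1.\<close>

definition tv_dist :: "'a measure \<Rightarrow> 'a measure \<Rightarrow> real" where
  "tv_dist M N = 2 * (SUP B\<in>sets M. \<bar>measure M B - measure N B\<bar>)"

text \<open>
  The cost functional is a real-valued Bochner integral and a real infimum, so this is the
  optimal cost only if \<open>c\<close> is such that all these integrals exist and are bounded below, for
  instance if \<open>c\<close> is measurable and bounded.
\<close>

definition opt_cost :: "'b::topological_space set \<Rightarrow> 'u::topological_space set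
    \<Rightarrow> ('a \<times> 'u \<Rightarrow> real) \<Rightarrow> 'a measure \<Rightarrow> ('a \<Rightarrow> 'b measure) \<Rightarrow> real" where
  "opt_cost Y U c P Q =
     (INF \<gamma> \<in> borel_on Y \<rightarrow>\<^sub>M borel_on U. \<integral>z. c (fst z, \<gamma> (snd z)) \<partial>joint_measure Y P Q)"

definition tv_tendsto :: "'b::topological_space set \<Rightarrow> 'a measure \<Rightarrow> (nat \<Rightarrow> 'a \<Rightarrow> 'b measure)
    \<Rightarrow> ('a \<Rightarrow> 'b measure) \<Rightarrow> bool" where
  "tv_tendsto Y P Qs Q \<longleftrightarrow>
     (\<lambda>i. tv_dist (joint_measure Y P (Qs i)) (joint_measure Y P Q)) \<longlonglongrightarrow> 0"

text \<open>
  The topology of the pseudometric \<open>(Q, Q') \<mapsto> \<parallel>PQ - PQ'\<parallel>\<close> on channels. Channels with the same joint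
  measure are not identified but topologically indistinguishable.
\<close>

definition tv_topology :: "'a::topological_space set \<Rightarrow> 'b::topological_space set \<Rightarrow> 'a measure
    \<Rightarrow> ('a \<Rightarrow> 'b measure) topology" where
  "tv_topology X Y P = topology (\<lambda>S. S \<subseteq> channels X Y \<and>
     (\<forall>Q\<in>S. \<exists>e>0. \<forall>Q'\<in>channels X Y.
        tv_dist (joint_measure Y P Q') (joint_measure Y P Q) < e \<longrightarrow> Q' \<in> S))"

lemma openin_tv_topology:
  "openin (tv_topology X Y P) S \<longleftrightarrow> S \<subseteq> channels X Y \<and>
     (\<forall>Q\<in>S. \<exists>e>0. \<forall>Q'\<in>channels X Y.
        tv_dist (joint_measure Y P Q') (joint_measure Y P Q) < e \<longrightarrow> Q' \<in> S)"
proof -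
  have "istopology (\<lambda>S. S \<subseteq> channels X Y \<and>
     (\<forall>Q\<in>S. \<exists>e>0. \<forall>Q'\<in>channels X Y.
        tv_dist (joint_measure Y P Q') (joint_measure Y P Q) < e \<longrightarrow> Q' \<in> S))"
    (is "istopology ?L")
    unfolding istopology_def
  proof (intro conjI allI impI)
    fix S T assume S: "?L S" and T: "?L T"
    show "S \<inter> T \<subseteq> channels X Y" using S by auto
    show "\<forall>Q\<in>S \<inter> T. \<exists>e>0. \<forall>Q'\<in>channels X Y.
        tv_dist (joint_measure Y P Q') (joint_measure Y P Q) < e \<longrightarrow> Q' \<in> S \<inter> T"
    proof
      fix Q assume "Q \<in> S \<inter> T"
      then obtain d e where
        "d > 0" "\<forall>Q'\<in>channels X Y. tv_dist (joint_measure Y P Q') (joint_measure Y P Q) < d \<longrightarrow> Q' \<in> S"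
        "e > 0" "\<forall>Q'\<in>channels X Y. tv_dist (joint_measure Y P Q') (joint_measure Y P Q) < e \<longrightarrow> Q' \<in> T"
        using S T by blast
      then show "\<exists>e>0. \<forall>Q'\<in>channels X Y.
          tv_dist (joint_measure Y P Q') (joint_measure Y P Q) < e \<longrightarrow> Q' \<in> S \<inter> T"
        by (intro exI[of _ "min d e"]) auto
    qed
  next
    fix K assume K: "\<forall>S\<in>K. ?L S"
    show "\<Union>K \<subseteq> channels X Y" using K by auto
    show "\<forall>Q\<in>\<Union>K. \<exists>e>0. \<forall>Q'\<in>channels X Y.
        tv_dist (joint_measure Y P Q') (joint_measure Y P Q) < e \<longrightarrow> Q' \<in> \<Union>K"
    proof
      fix Q assume "Q \<in> \<Union>K"
      then obtain S where S: "S \<in> K" "Q \<in> S" by blast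
      then obtain e where "e > 0" "\<forall>Q'\<in>channels X Y.
          tv_dist (joint_measure Y P Q') (joint_measure Y P Q) < e \<longrightarrow> Q' \<in> S"
        using K by blast
      with S(1) show "\<exists>e>0. \<forall>Q'\<in>channels X Y.
          tv_dist (joint_measure Y P Q') (joint_measure Y P Q) < e \<longrightarrow> Q' \<in> \<Union>K"
        by blast
    qed
  qed
  then show ?thesis
    unfolding tv_topology_def by (simp add: topology_inverse')
qed

lemma topspace_tv_topology: "topspace (tv_topology X Y P) = channels X Y"
proof
  show "topspace (tv_topology X Y P) \<subseteq> channels X Y"
    using openin_topspace[of "tv_topology X Y P"] unfolding openin_tv_topology by blast
  have "openin (tv_topology X Y P) (channels X Y)"
    unfolding openin_tv_topology by (auto intro: exI[of _ 1])
  then show "channels X Y \<subseteq> topspace (tv_topology X Y P)"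
    by (rule openin_subset)
qed

end

theory Submission
  imports Defs
begin

text \<open>
  The joint laws \<open>PQ\<close> enter the optimal cost only through the integrals of the functions
  \<open>(x, y) \<mapsto> c (x, \<gamma> y)\<close>, all of which take values in one interval \<open>[0, K]\<close>. Integrating the
  tails of such a function over \<open>[0, K]\<close> shows that its integral moves by at most \<open>K\<close> times the
  largest change in the probability of an event, which is half the total variation distance
  (\<open>abs_integral_diff_le_tv_dist\<close>). As this bound does not depend on the policy \<open>\<gamma>\<close>, it survives
  the infimum over policies. Hence \<open>J(P, \<cdot>)\<close> is Lipschitz for the total variation pseudometric
  (\<open>abs_opt_cost_diff_le_tv_dist\<close>), which gives continuity and convergence along sequences.
\<close>

section \<open>Integrals of bounded functions under nearby measures\<close>

text \<open>
  By Tonelli: \<open>f x\<close> is the length of the interval of those \<open>t \<ge> 0\<close> with \<open>t < f x\<close>. Restricting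
  \<open>t\<close> to \<open>[0, K)\<close> confines the error from replacing \<open>M\<close> by another measure to a bounded interval.
\<close>

lemma nn_integral_eq_integral_tails:
  assumes "sigma_finite_measure M" and [measurable]: "f \<in> borel_measurable M"
    and bounds: "\<And>x. x \<in> space M \<Longrightarrow> 0 \<le> f x \<and> f x \<le> (K::real)"
  shows "(\<integral>\<^sup>+x. ennreal (f x) \<partial>M)
    = (\<integral>\<^sup>+t. emeasure M {x \<in> space M. t < f x} * indicator {0..<K} t \<partial>lborel)"
proof -
  interpret sigma_finite_measure M by fact
  interpret pair_sigma_finite lborel M ..
  have "(\<integral>\<^sup>+x. ennreal (f x) \<partial>M)
      = (\<integral>\<^sup>+x. (\<integral>\<^sup>+t. indicator {t. t < f x} t * indicator {0..<K} t \<partial>lborel) \<partial>M)"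
  proof (rule nn_integral_cong)
    fix x assume x: "x \<in> space M"
    have "(\<integral>\<^sup>+t. indicator {t. t < f x} t * indicator {0..<K} t \<partial>lborel)
        = (\<integral>\<^sup>+t. indicator {0..<f x} t \<partial>lborel)"
      using bounds[OF x] by (intro nn_integral_cong) (auto split: split_indicator)
    then show "ennreal (f x) = (\<integral>\<^sup>+t. indicator {t. t < f x} t * indicator {0..<K} t \<partial>lborel)"
      using bounds[OF x] by simp
  qed
  also have "\<dots> = (\<integral>\<^sup>+t. (\<integral>\<^sup>+x. indicator {t. t < f x} t * indicator {0..<K} t \<partial>M) \<partial>lborel)"
    by (rule Fubini') (simp add: indicator_def)
  also have "\<dots> = (\<integral>\<^sup>+t. emeasure M {x \<in> space M. t < f x} * indicator {0..<K} t \<partial>lborel)"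
  proof (rule nn_integral_cong)
    fix t :: real
    have "(\<integral>\<^sup>+x. indicator {t. t < f x} t * indicator {0..<K} t \<partial>M)
        = (\<integral>\<^sup>+x. indicator {x \<in> space M. t < f x} x * indicator {0..<K} t \<partial>M)"
      by (intro nn_integral_cong) (auto split: split_indicator)
    then show "(\<integral>\<^sup>+x. indicator {t. t < f x} t * indicator {0..<K} t \<partial>M)
        = emeasure M {x \<in> space M. t < f x} * indicator {0..<K} t"
      by (simp add: nn_integral_multc)
  qed
  finally show ?thesis .
qed

text \<open>
  Passing from \<open>M\<close> to \<open>N\<close> costs at most \<open>d\<close> at each level \<open>t\<close> of the tail integral, and only the
  levels in \<open>[0, K)\<close> count. The hypothesis is one-sided so that the two-sided estimate follows by
  exchanging the measures.
\<close>

lemma nn_integral_le_if_measure_le: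
  assumes "prob_space M" and "prob_space N" and sets_eq: "sets M = sets N"
    and f: "f \<in> borel_measurable M"
    and bounds: "\<And>x. x \<in> space M \<Longrightarrow> 0 \<le> f x \<and> f x \<le> (K::real)"
    and d: "\<And>B. B \<in> sets M \<Longrightarrow> measure M B \<le> measure N B + d"
  shows "(\<integral>\<^sup>+x. ennreal (f x) \<partial>M) \<le> (\<integral>\<^sup>+x. ennreal (f x) \<partial>N) + ennreal (K * d)"
proof -
  interpret M: prob_space M by fact
  interpret N: prob_space N by fact
  note [measurable] = f
  have [measurable]: "f \<in> borel_measurable N"
    using f by (simp add: measurable_cong_sets[OF sets_eq refl])
  have space_eq: "space M = space N"
    using sets_eq by (rule sets_eq_imp_space_eq)
  have d0: "0 \<le> d"
    using d[of "{}"] by simp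
  obtain x where "x \<in> space M"
    using M.not_empty by blast
  then have K0: "0 \<le> K"
    using bounds[of x] by linarith
  have le: "emeasure M {x \<in> space M. t < f x} \<le> emeasure N {x \<in> space N. t < f x} + ennreal d" for t
  proof -
    have "{x \<in> space M. t < f x} \<in> sets M" by measurable
    from d[OF this] show ?thesis
      using d0 by (simp add: M.emeasure_eq_measure N.emeasure_eq_measure space_eq
        ennreal_plus[symmetric] del: ennreal_plus)
  qed
  have tail_measurable: "(\<lambda>t. emeasure N {x \<in> space N. t < f x}) \<in> borel_measurable lborel"
  proof -
    have "{p \<in> space (lborel \<Otimes>\<^sub>M N). fst p < f (snd p)} \<in> sets (lborel \<Otimes>\<^sub>M N)"
      by measurable
    from N.measurable_emeasure_Pair[OF this] show ?thesis
      by (simp add: space_pair_measure vimage_def)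
  qed
  have "(\<integral>\<^sup>+x. ennreal (f x) \<partial>M)
      = (\<integral>\<^sup>+t. emeasure M {x \<in> space M. t < f x} * indicator {0..<K} t \<partial>lborel)"
    using f bounds by (intro nn_integral_eq_integral_tails) unfold_locales
  also have "\<dots> \<le> (\<integral>\<^sup>+t. emeasure N {x \<in> space N. t < f x} * indicator {0..<K} t
      + ennreal d * indicator {0..<K} t \<partial>lborel)"
    using le by (intro nn_integral_mono) (simp split: split_indicator)
  also have "\<dots> = (\<integral>\<^sup>+t. emeasure N {x \<in> space N. t < f x} * indicator {0..<K} t \<partial>lborel)
      + (\<integral>\<^sup>+t. ennreal d * indicator {0..<K} t \<partial>lborel)"
    using tail_measurable by (intro nn_integral_add) auto
  also have "(\<integral>\<^sup>+t. ennreal d * indicator {0..<K} t \<partial>lborel) = ennreal (K * d)"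
    using K0 d0 by (simp add: nn_integral_cmult_indicator ennreal_mult mult.commute)
  also have "(\<integral>\<^sup>+t. emeasure N {x \<in> space N. t < f x} * indicator {0..<K} t \<partial>lborel)
      = (\<integral>\<^sup>+x. ennreal (f x) \<partial>N)"
    using bounds by (intro nn_integral_eq_integral_tails[symmetric]) (unfold_locales, auto simp: space_eq)
  finally show ?thesis .
qed

lemma integral_le_if_measure_le:
  assumes M: "prob_space M" and N: "prob_space N" and sets_eq: "sets M = sets N"
    and f: "f \<in> borel_measurable M"
    and bounds: "\<And>x. x \<in> space M \<Longrightarrow> 0 \<le> f x \<and> f x \<le> (K::real)"
    and d: "\<And>B. B \<in> sets M \<Longrightarrow> measure M B \<le> measure N B + d"
  shows "(\<integral>x. f x \<partial>M) \<le> (\<integral>x. f x \<partial>N) + K * d"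
proof -
  interpret M: prob_space M by fact
  interpret N: prob_space N by fact
  have fN: "f \<in> borel_measurable N"
    using f by (simp add: measurable_cong_sets[OF sets_eq refl])
  have space_eq: "space M = space N"
    using sets_eq by (rule sets_eq_imp_space_eq)
  have "integrable M f" "integrable N f"
    using f fN bounds space_eq
    by (auto intro!: M.integrable_const_bound[where B=K] N.integrable_const_bound[where B=K] AE_I2)
  moreover obtain x where "x \<in> space M"
    using M.not_empty by blast
  then have "0 \<le> K"
    using bounds[of x] by linarith
  moreover have "0 \<le> d"
    using d[of "{}"] by simp
  moreover have "0 \<le> (\<integral>x. f x \<partial>N)"
    using bounds space_eq by (intro integral_nonneg_AE AE_I2) auto
  moreover have "AE x in M. 0 \<le> f x" "AE x in N. 0 \<le> f x"
    using bounds space_eq by (auto intro!: AE_I2)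
  ultimately show ?thesis
    using nn_integral_le_if_measure_le[OF M N sets_eq f bounds d]
    by (simp add: nn_integral_eq_integral ennreal_plus[symmetric] ennreal_le_iff del: ennreal_plus)
qed

text \<open>
  The supremum defining the total variation distance is over a set bounded by 1, so it dominates
  each of its members.
\<close>

lemma abs_measure_diff_le_tv_dist:
  assumes "prob_space M" and "prob_space N" and "B \<in> sets M"
  shows "\<bar>measure M B - measure N B\<bar> \<le> tv_dist M N / 2"
proof -
  have bound: "\<bar>measure M A - measure N A\<bar> \<le> 1" for A
    using prob_space.prob_le_1[OF assms(1), of A] prob_space.prob_le_1[OF assms(2), of A]
      measure_nonneg[of M A] measure_nonneg[of N A] by linarith
  have "\<bar>measure M B - measure N B\<bar> \<le> (SUP B\<in>sets M. \<bar>measure M B - measure N B\<bar>)"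
    using assms(3) bound by (intro cSUP_upper) (auto intro!: bdd_aboveI[where M=1])
  then show ?thesis
    by (simp add: tv_dist_def)
qed

lemma abs_integral_diff_le_tv_dist:
  assumes M: "prob_space M" and N: "prob_space N" and sets_eq: "sets M = sets N"
    and f: "f \<in> borel_measurable M"
    and bounds: "\<And>x. x \<in> space M \<Longrightarrow> 0 \<le> f x \<and> f x \<le> (K::real)"
  shows "\<bar>(\<integral>x. f x \<partial>M) - (\<integral>x. f x \<partial>N)\<bar> \<le> K * (tv_dist M N / 2)"
proof -
  have fN: "f \<in> borel_measurable N"
    using f by (simp add: measurable_cong_sets[OF sets_eq refl])
  have boundsN: "0 \<le> f x \<and> f x \<le> K" if "x \<in> space N" for x
    using bounds that sets_eq_imp_space_eq[OF sets_eq] by simp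
  have diff: "\<bar>measure M B - measure N B\<bar> \<le> tv_dist M N / 2" if "B \<in> sets M" for B
    using that by (rule abs_measure_diff_le_tv_dist[OF M N])
  have "measure M B \<le> measure N B + tv_dist M N / 2" if "B \<in> sets M" for B
    using diff[OF that] by linarith
  from integral_le_if_measure_le[OF M N sets_eq f bounds this]
  have "(\<integral>x. f x \<partial>M) \<le> (\<integral>x. f x \<partial>N) + K * (tv_dist M N / 2)" .
  moreover have "measure N B \<le> measure M B + tv_dist M N / 2" if "B \<in> sets N" for B
  proof -
    have "\<bar>measure M B - measure N B\<bar> \<le> tv_dist M N / 2"
      using that sets_eq by (intro diff) simp
    then show ?thesis
      by linarith
  qed
  from integral_le_if_measure_le[OF N M sets_eq[symmetric] fN boundsN this]
  have "(\<integral>x. f x \<partial>N) \<le> (\<integral>x. f x \<partial>M) + K * (tv_dist M N / 2)" .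
  ultimately show ?thesis
    by linarith
qed

section \<open>The optimal cost as a function of the channel\<close>

lemma prob_space_joint_measure:
  fixes X :: "'a::topological_space set" and Y :: "'b::topological_space set"
  assumes P: "prob_space P" and sets_P: "sets P = sets (borel_on X)" and Q: "Q \<in> channels X Y"
  shows "prob_space (joint_measure Y P Q)"
proof
  have space_P: "space P = X"
    using sets_eq_imp_space_eq[OF sets_P] by (simp add: space_restrict_space)
  have Qx: "prob_space (Q x)" "space (Q x) = Y" if "x \<in> X" for x
    using Q that sets_eq_imp_space_eq[of "Q x" "borel_on Y"]
    by (auto simp: channels_iff space_restrict_space)
  have "space P \<times> Y = space (P \<Otimes>\<^sub>M borel_on Y)"
    by (simp add: space_pair_measure space_restrict_space)
  then have "space P \<times> Y \<in> sets (P \<Otimes>\<^sub>M borel_on Y)"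
    using sets.top by metis
  then have "emeasure (joint_measure Y P Q) (space P \<times> Y)
      = (\<integral>\<^sup>+x. emeasure (Q x) (Pair x -` (space P \<times> Y)) \<partial>P)"
    by (rule emeasure_joint_measure[OF sets_P Q])
  also have "\<dots> = (\<integral>\<^sup>+x. 1 \<partial>P)"
  proof (rule nn_integral_cong)
    fix x assume x: "x \<in> space P"
    then have "Pair x -` (space P \<times> Y) = space (Q x)"
      using Qx(2) space_P by auto
    then show "emeasure (Q x) (Pair x -` (space P \<times> Y)) = 1"
      using prob_space.emeasure_space_1[OF Qx(1)] x space_P by simp
  qed
  finally show "emeasure (joint_measure Y P Q) (space (joint_measure Y P Q)) = 1"
    using prob_space.emeasure_space_1[OF P] by (simp add: space_joint_measure)
qed

lemma abs_cINF_diff_le: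
  fixes f g :: "'a \<Rightarrow> real"
  assumes ne: "A \<noteq> {}" and f: "bdd_below (f ` A)" and g: "bdd_below (g ` A)"
    and d: "\<And>a. a \<in> A \<Longrightarrow> \<bar>f a - g a\<bar> \<le> d"
  shows "\<bar>(INF a\<in>A. f a) - (INF a\<in>A. g a)\<bar> \<le> d"
proof -
  have "(INF a\<in>A. f a) - d \<le> (INF a\<in>A. g a)"
  proof (rule cINF_greatest[OF ne])
    fix a assume "a \<in> A"
    then show "(INF a\<in>A. f a) - d \<le> g a"
      using d[of a] cINF_lower[OF f, of a] by linarith
  qed
  moreover have "(INF a\<in>A. g a) - d \<le> (INF a\<in>A. f a)"
  proof (rule cINF_greatest[OF ne])
    fix a assume "a \<in> A"
    then show "(INF a\<in>A. g a) - d \<le> f a"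
      using d[of a] cINF_lower[OF g, of a] by linarith
  qed
  ultimately show ?thesis
    by linarith
qed

text \<open>
  Each policy has the same cost integrand under both joint laws, so its two expected costs differ
  by an amount bounded uniformly in the policy. The real infima behave as expected because a
  constant policy exists and no cost is negative.
\<close>

lemma abs_opt_cost_diff_le_tv_dist:
  fixes X :: "'a::topological_space set" and Y :: "'b::topological_space set"
    and U :: "'u::topological_space set" and c :: "'a \<times> 'u \<Rightarrow> real"
  assumes "U \<noteq> {}" and P: "prob_space P" and sets_P: "sets P = sets (borel_on X)"
    and c: "c \<in> borel_measurable (borel_on X \<Otimes>\<^sub>M borel_on U)"
    and bounds: "\<And>x u. x \<in> X \<Longrightarrow> u \<in> U \<Longrightarrow> 0 \<le> c (x, u) \<and> c (x, u) \<le> K"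
    and Q: "Q \<in> channels X Y" and Q': "Q' \<in> channels X Y"
  shows "\<bar>opt_cost Y U c P Q - opt_cost Y U c P Q'\<bar>
    \<le> K * (tv_dist (joint_measure Y P Q) (joint_measure Y P Q') / 2)"
proof -
  let ?policies = "borel_on Y \<rightarrow>\<^sub>M borel_on U"
  have space_P: "space P = X"
    using sets_eq_imp_space_eq[OF sets_P] by (simp add: space_restrict_space)
  have cost_measurable:
    "(\<lambda>z. c (fst z, \<gamma> (snd z))) \<in> borel_measurable (joint_measure Y P R)"
    if "\<gamma> \<in> ?policies" for \<gamma> R
  proof -
    note [measurable] = c that
    have "(\<lambda>z. c (fst z, \<gamma> (snd z))) \<in> borel_measurable (borel_on X \<Otimes>\<^sub>M borel_on Y)"
      by measurable
    moreover have "sets (joint_measure Y P R) = sets (borel_on X \<Otimes>\<^sub>M borel_on Y)"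
      using sets_P by (simp add: sets_joint_measure cong: sets_pair_measure_cong)
    ultimately show ?thesis
      by (simp cong: measurable_cong_sets)
  qed
  have cost_bounds: "0 \<le> c (fst z, \<gamma> (snd z)) \<and> c (fst z, \<gamma> (snd z)) \<le> K"
    if "\<gamma> \<in> ?policies" "z \<in> space (joint_measure Y P R)" for \<gamma> z R
    using that bounds measurable_space[OF that(1), of "snd z"] space_P
    by (auto simp: space_joint_measure space_restrict_space)
  have bdd: "bdd_below ((\<lambda>\<gamma>. \<integral>z. c (fst z, \<gamma> (snd z)) \<partial>joint_measure Y P R) ` ?policies)" for R
    using cost_bounds by (intro bdd_belowI2[where m=0] integral_nonneg_AE AE_I2) blast
  obtain u where "u \<in> U"
    using \<open>U \<noteq> {}\<close> by blast
  then have "(\<lambda>_. u) \<in> ?policies"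
    by (simp add: space_restrict_space)
  then have "?policies \<noteq> {}"
    by blast
  then show ?thesis
    unfolding opt_cost_def
    using bdd bdd
  proof (rule abs_cINF_diff_le)
    fix \<gamma> assume \<gamma>: "\<gamma> \<in> ?policies"
    show "\<bar>(\<integral>z. c (fst z, \<gamma> (snd z)) \<partial>joint_measure Y P Q)
        - (\<integral>z. c (fst z, \<gamma> (snd z)) \<partial>joint_measure Y P Q')\<bar>
      \<le> K * (tv_dist (joint_measure Y P Q) (joint_measure Y P Q') / 2)"
      using prob_space_joint_measure[OF P sets_P Q] prob_space_joint_measure[OF P sets_P Q']
        cost_measurable[OF \<gamma>] cost_bounds[OF \<gamma>]
      by (intro abs_integral_diff_le_tv_dist) (simp_all add: sets_joint_measure)
  qed
qed

section \<open>Continuity in the total variation topology\<close>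

lemma continuous_map_tv_topology_if_lipschitz:
  fixes J :: "('a::topological_space \<Rightarrow> 'b::topological_space measure) \<Rightarrow> real"
  assumes L: "\<And>Q Q'. Q \<in> channels X Y \<Longrightarrow> Q' \<in> channels X Y \<Longrightarrow>
      \<bar>J Q' - J Q\<bar> \<le> L * tv_dist (joint_measure Y P Q') (joint_measure Y P Q)"
    and "0 < L"
  shows "continuous_map (tv_topology X Y P) euclideanreal J"
  unfolding continuous_map_def topspace_tv_topology
proof (intro conjI allI impI)
  fix V :: "real set" assume "openin euclideanreal V"
  then have V: "open V"
    by simp
  show "openin (tv_topology X Y P) {Q \<in> channels X Y. J Q \<in> V}"
    unfolding openin_tv_topology
  proof (intro conjI ballI)
    fix Q assume Q: "Q \<in> {Q \<in> channels X Y. J Q \<in> V}"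
    then obtain e where e: "0 < e" "\<And>r. \<bar>r - J Q\<bar> < e \<Longrightarrow> r \<in> V"
      using V unfolding open_dist dist_real_def by blast
    have "Q' \<in> {Q \<in> channels X Y. J Q \<in> V}" if Q': "Q' \<in> channels X Y"
      and close: "tv_dist (joint_measure Y P Q') (joint_measure Y P Q) < e / L" for Q'
    proof -
      have "\<bar>J Q' - J Q\<bar> \<le> L * tv_dist (joint_measure Y P Q') (joint_measure Y P Q)"
        using Q Q' L by blast
      also have "\<dots> < e"
        using close \<open>0 < L\<close> by (simp add: field_simps)
      finally show ?thesis
        using Q' e(2) by blast
    qed
    moreover have "0 < e / L"
      using e(1) \<open>0 < L\<close> by simp
    ultimately show "\<exists>e>0. \<forall>Q'\<in>channels X Y.
        tv_dist (joint_measure Y P Q') (joint_measure Y P Q) < e \<longrightarrow> Q' \<in> {Q \<in> channels X Y. J Q \<in> V}"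
      by blast
  qed auto
qed simp

theorem theorem3p4:
  fixes X :: "(real ^ 'n) set" and Y :: "(real ^ 'm) set" and U :: "(real ^ 'k) set"
    and P :: "(real ^ 'n) measure" and c :: "(real ^ 'n) \<times> (real ^ 'k) \<Rightarrow> real"
  assumes "X \<in> sets borel" and "Y \<in> sets borel" and "U \<in> sets borel" and "U \<noteq> {}"
    and "prob_space P" and "sets P = sets (borel_on X)"
    and "c \<in> borel_measurable (borel_on X \<Otimes>\<^sub>M borel_on U)"
    and "\<And>x u. x \<in> X \<Longrightarrow> u \<in> U \<Longrightarrow> 0 \<le> c (x, u)"
    and "bounded (c ` (X \<times> U))"
  shows "continuous_map (tv_topology X Y P) euclideanreal (opt_cost Y U c P) \<and>
    (\<forall>Qs Q. (\<forall>i. Qs i \<in> channels X Y) \<longrightarrow> Q \<in> channels X Y \<longrightarrow> tv_tendsto Y P Qs Q \<longrightarrow>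
       (\<lambda>i. opt_cost Y U c P (Qs i)) \<longlonglongrightarrow> opt_cost Y U c P Q)"
proof -
  obtain K where K: "0 < K" "\<And>p. p \<in> X \<times> U \<Longrightarrow> \<bar>c p\<bar> \<le> K"
    using assms(9) unfolding bounded_pos by auto
  have bounds: "0 \<le> c (x, u) \<and> c (x, u) \<le> K" if "x \<in> X" "u \<in> U" for x u
    using assms(8)[OF that] K(2)[of "(x, u)"] that by auto
  have lipschitz: "\<bar>opt_cost Y U c P Q' - opt_cost Y U c P Q\<bar>
      \<le> K / 2 * tv_dist (joint_measure Y P Q') (joint_measure Y P Q)"
    if "Q \<in> channels X Y" "Q' \<in> channels X Y" for Q Q'
    using abs_opt_cost_diff_le_tv_dist[OF assms(4-7) bounds that(2) that(1)] by simp
  show ?thesis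
  proof (intro conjI allI impI)
    show "continuous_map (tv_topology X Y P) euclideanreal (opt_cost Y U c P)"
      using K(1) lipschitz
      by (intro continuous_map_tv_topology_if_lipschitz[where L = "K / 2"]) auto
  next
    fix Qs Q
    assume Qs: "\<forall>i. Qs i \<in> channels X Y" and Q: "Q \<in> channels X Y" and conv: "tv_tendsto Y P Qs Q"
    have "(\<lambda>i. K / 2 * tv_dist (joint_measure Y P (Qs i)) (joint_measure Y P Q)) \<longlonglongrightarrow> 0"
      using conv[unfolded tv_tendsto_def] by (rule tendsto_mult_right_zero)
    moreover have "\<forall>\<^sub>F i in sequentially. norm (opt_cost Y U c P (Qs i) - opt_cost Y U c P Q)
        \<le> K / 2 * tv_dist (joint_measure Y P (Qs i)) (joint_measure Y P Q)"
      using lipschitz[OF Q Qs[rule_format]] by (simp only: real_norm_def always_eventually simp_thms)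
    ultimately have "(\<lambda>i. opt_cost Y U c P (Qs i) - opt_cost Y U c P Q) \<longlonglongrightarrow> 0"
      by (rule Lim_null_comparison[rotated])
    then show "(\<lambda>i. opt_cost Y U c P (Qs i)) \<longlonglongrightarrow> opt_cost Y U c P Q"
      by (rule LIM_zero_cancel)
  qed
qed

end
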